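(* For every integer $n \ge 0$, let $d_2^e(n)$ (respectively $d_2^o(n)$) be the number of overpartitions of $n$ in which only even parts may be overlined and which have an even (respectively odd) number of parts. For an integer $m$ let $\omega_m = m(3m+1)/2$. Then for all $n\ge 0$, $$d_2^e(n) \equiv \begin{cases} 1 \pmod 2 & \text{if } n=\omega_{4k} \text{ or } n=\omega_{4k+1} \text{ for some integer } k,\\ 0 \pmod 2 & \text{otherwise},\end{cases}$$ $$d_2^o(n) \equiv \begin{cases} 1 \pmod 2 & \text{if } n=\omega_{4k+2} \text{ or } n=\omega_{4k+3} \text{ for some integer } k,\\ 0 \pmod 2 & \text{otherwise}.\end{cases}$$
   Context: An overpartition of $n$ is a partition of $n$ in which the first occurrence of each distinct part value may be overlined; equivalently a pair $(\mu,\nu)$ with $\mu$ a partition (non-overlined parts), $\nu$ a partition into distinct parts (overlined parts), $|\mu|+|\nu|=n$. Overpartitions "in which only even parts may be overlined" are those where all overlined parts are even. The number of parts (length) counts all parts, overlined or not; the empty partition of $0$ has length $0$. The integer $k$ ranges over all integers, including negative ones. *)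

theory Defs
  imports "HOL-Library.Multiset" "HOL-Number_Theory.Cong"
begin

text \<open>
  An overpartition is a pair of multisets of positive parts: the non-overlined parts and the
  overlined parts. A value may occur in both components, but at most one copy of it is overlined.
\<close>

definition overpartition :: "nat \<Rightarrow> nat multiset \<times> nat multiset \<Rightarrow> bool" where
  "overpartition n = (\<lambda>(\<mu>, \<nu>).
     (\<forall>p \<in># \<mu>. 0 < p) \<and> (\<forall>p \<in># \<nu>. 0 < p) \<and> (\<forall>p. count \<nu> p \<le> 1) \<and>
     \<Sum>\<^sub># \<mu> + \<Sum>\<^sub># \<nu> = n)"

definition even_overlined :: "nat multiset \<times> nat multiset \<Rightarrow> bool" where
  "even_overlined = (\<lambda>(\<mu>, \<nu>). \<forall>p \<in># \<nu>. even p)"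

definition num_parts :: "nat multiset \<times> nat multiset \<Rightarrow> nat" where
  "num_parts = (\<lambda>(\<mu>, \<nu>). size \<mu> + size \<nu>)"

definition d2e :: "nat \<Rightarrow> nat" where
  "d2e n = card {\<pi>. overpartition n \<pi> \<and> even_overlined \<pi> \<and> even (num_parts \<pi>)}"

definition d2o :: "nat \<Rightarrow> nat" where
  "d2o n = card {\<pi>. overpartition n \<pi> \<and> even_overlined \<pi> \<and> odd (num_parts \<pi>)}"

text \<open>The integer division is exact, since \<open>m\<close> and \<open>3 * m + 1\<close> have opposite parity.\<close>

definition omega :: "int \<Rightarrow> int" where
  "omega m = m * (3 * m + 1) div 2"

lemma size_le_sum_mset:
  fixes M :: "nat multiset"
  assumes "\<forall>p \<in># M. 0 < p"
  shows "size M \<le> \<Sum>\<^sub># M"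
  using assms by (induction M) auto

lemma elem_le_sum_mset:
  fixes M :: "nat multiset"
  assumes "p \<in># M"
  shows "p \<le> \<Sum>\<^sub># M"
  using assms by (induction M) auto

text \<open>Finiteness ensures that \<^const>\<open>card\<close> counts as intended in the definitions above.\<close>

lemma finite_overpartitions: "finite {\<pi>. overpartition n \<pi>}"
proof -
  let ?F = "mset ` {xs. set xs \<subseteq> {..n} \<and> length xs \<le> n}"
  have *: "M \<in> ?F" if "\<forall>p \<in># M. 0 < p" "\<Sum>\<^sub># M \<le> n" for M :: "nat multiset"
  proof -
    obtain xs where xs: "M = mset xs" by (metis ex_mset)
    have "length xs \<le> n"
      using size_le_sum_mset[OF that(1)] that(2) xs by simp
    moreover have "set xs \<subseteq> {..n}"
      using elem_le_sum_mset[of _ M] that(2) xs by (auto intro: order_trans)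
    ultimately show ?thesis using xs by blast
  qed
  have "{\<pi>. overpartition n \<pi>} \<subseteq> ?F \<times> ?F"
    using * by (auto simp: overpartition_def simp del: mem_Collect_eq) 
  then show ?thesis
    by (rule finite_subset) (intro finite_cartesian_product finite_imageI finite_lists_length_le; simp)
qed

end

theory Submission
  imports Defs "HOL-Library.Z2" "HOL-Library.Disjoint_Sets" "HOL-Computational_Algebra.Formal_Power_Series"
begin

text \<open>
  Toggling the overline on one copy of the largest even part is a fixed-point-free involution on
  the overpartitions that have an even part, and it keeps the number of parts. Modulo 2 only the
  partitions of \<open>n\<close> into odd parts remain, and these have \<open>n\<close> parts modulo 2. Their number is
  congruent to the \<open>n\<close>-th coefficient of the Euler product \<open>P(x) = \<Prod>(1 - x\<^sup>k)\<close>: over the field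
  with two elements \<open>P(x) = \<Prod>\<^bsub>k odd\<^esub> (1 - x\<^sup>k) P(x\<^sup>2) = \<Prod>\<^bsub>k odd\<^esub> (1 - x\<^sup>k) P(x)\<^sup>2\<close>. By the
  pentagonal number theorem it is odd iff \<open>n = \<omega>\<^sub>m\<close> for some \<open>m\<close>; and \<open>\<omega>\<^sub>m\<close> is even iff
  \<open>m\<close> is 0 or 1 modulo 4.
\<close>

unbundle fps_syntax

section \<open>Finite form of the pentagonal number theorem\<close>

definition euler_prod :: "'a::comm_ring_1 \<Rightarrow> nat \<Rightarrow> nat \<Rightarrow> 'a" where
  "euler_prod x m n = (\<Prod>k\<in>{m<..n}. 1 - x ^ k)"

lemma euler_prod_self [simp]: "euler_prod x n n = 1"
  by (simp add: euler_prod_def)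

lemma euler_prod_Suc_right:
  "m \<le> n \<Longrightarrow> euler_prod x m (Suc n) = euler_prod x m n * (1 - x ^ Suc n)"
proof -
  assume "m \<le> n"
  then have "{m<..Suc n} = insert (Suc n) {m<..n}" by auto
  then show ?thesis by (simp add: euler_prod_def mult.commute)
qed

lemma euler_prod_Suc_left:
  "m < n \<Longrightarrow> euler_prod x m n = (1 - x ^ Suc m) * euler_prod x (Suc m) n"
proof -
  assume "m < n"
  then have "{m<..n} = insert (Suc m) {Suc m<..n}" by auto
  then show ?thesis by (simp add: euler_prod_def)
qed

text \<open>Shanks' summand contains the quotient (x)_n / (x)_s, where (x)_n = (1 - x) ... (1 -
  x^n). Written as \<open>euler_prod x s n\<close> it needs no division, so the identity makes sense
  in every commutative ring.\<close>

definition shanks_term :: "'a::comm_ring_1 \<Rightarrow> nat \<Rightarrow> nat \<Rightarrow> 'a" where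
  "shanks_term x n s = (-1) ^ s * x ^ (s * n + s * (s + 1) div 2) * euler_prod x s n"

lemma triangular_Suc: "Suc s * (Suc s + 1) div 2 = s * (s + 1) div 2 + Suc s"
  by simp

text \<open>The right side is b s - b (s + 1) for a single expression b, so the change from n to n +
  1 telescopes when summed over s.\<close>

lemma shanks_term_Suc_diff:
  assumes "s < n"
  shows "shanks_term x (Suc n) (Suc s) - shanks_term x n (Suc s) =
    (-1) ^ s * x ^ (Suc s * Suc n + s * (s + 1) div 2) * euler_prod x s n
    - (-1) ^ Suc s * x ^ (Suc (Suc s) * Suc n + Suc s * (Suc s + 1) div 2) * euler_prod x (Suc s) n"
proof -
  define t where "t = s * (s + 1) div 2"
  define E where "E = euler_prod x (Suc s) n"
  have t: "Suc s * (Suc s + 1) div 2 = t + Suc s"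
    unfolding t_def by (rule triangular_Suc)
  have E: "euler_prod x s n = (1 - x ^ Suc s) * E" "euler_prod x (Suc s) (Suc n) = E * (1 - x ^ Suc n)"
    using assms by (simp_all only: E_def euler_prod_Suc_left [of s n] euler_prod_Suc_right Suc_leI)
  \<comment> \<open>Once this common power is split off, only a polynomial identity in x^(s+1) and
    x^(n+1) is left.\<close>
  have p: "x ^ (Suc s * Suc n + (t + Suc s)) = x ^ (Suc s * n + t + Suc s) * x ^ Suc s"
    "x ^ (Suc s * n + (t + Suc s)) = x ^ (Suc s * n + t + Suc s)"
    "x ^ (Suc s * Suc n + t) = x ^ (Suc s * n + t + Suc s)"
    "x ^ (Suc (Suc s) * Suc n + (t + Suc s)) = x ^ (Suc s * n + t + Suc s) * x ^ Suc s * x ^ Suc n"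
    unfolding power_add [symmetric] by (rule arg_cong [where f = "\<lambda>e. x ^ e"]; simp)+
  show ?thesis
    unfolding shanks_term_def t E t_def [symmetric] E_def [symmetric] p
    by (simp only: power_Suc [of "-1"]) (simp add: algebra_simps del: power_Suc)
qed

text \<open>
  Shanks' finite form of Euler's pentagonal number theorem. Modulo \<open>x ^ (n + 1)\<close> only the
  summand \<open>s = 0\<close>, which is the Euler product itself, survives on the left.
\<close>

lemma shanks_finite_pentagonal:
  "(\<Sum>s\<le>n. shanks_term x n s) =
    1 + (\<Sum>s = 1..n. (-1) ^ s * (x ^ (s * (3 * s - 1) div 2) + x ^ (s * (3 * s + 1) div 2)))"
proof (induction n)
  case 0
  show ?case by (simp add: shanks_term_def)
next
  case (Suc n)
  let ?b = "\<lambda>s. (-1) ^ s * x ^ (Suc s * Suc n + s * (s + 1) div 2) * euler_prod x s n"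
  have "(\<Sum>s\<le>n. shanks_term x (Suc n) s - shanks_term x n s)
      = (shanks_term x (Suc n) 0 - shanks_term x n 0) +
        (\<Sum>s<n. shanks_term x (Suc n) (Suc s) - shanks_term x n (Suc s))"
    by (simp only: lessThan_Suc_atMost [symmetric] sum.lessThan_Suc_shift)
  also have "(\<Sum>s<n. shanks_term x (Suc n) (Suc s) - shanks_term x n (Suc s)) = (\<Sum>s<n. ?b s - ?b (Suc s))"
    by (intro sum.cong refl shanks_term_Suc_diff) simp
  also have "\<dots> = ?b 0 - ?b n"
    by (rule sum_lessThan_telescope')
  \<comment> \<open>The change of the summand s = 0 cancels the front end b 0 of the
    telescope.\<close>
  also have "shanks_term x (Suc n) 0 - shanks_term x n 0 = - ?b 0"
    by (simp add: shanks_term_def euler_prod_Suc_right algebra_simps)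
  finally have *: "(\<Sum>s\<le>n. shanks_term x (Suc n) s) - (\<Sum>s\<le>n. shanks_term x n s) = - ?b n"
    by (simp add: sum_subtractf)
  \<comment> \<open>The surviving - b n and the new summand s = n + 1 supply the two pentagonal
    exponents of index n + 1.\<close>
  have e: "Suc n * Suc n + n * (n + 1) div 2 = Suc n * (3 * Suc n - 1) div 2"
    "Suc n * Suc n + Suc n * (Suc n + 1) div 2 = Suc n * (3 * Suc n + 1) div 2"
  proof -
    have "Suc n * (3 * Suc n - 1) = n * (n + 1) + Suc n * Suc n * 2"
      "Suc n * (3 * Suc n + 1) = Suc n * (Suc n + 1) + Suc n * Suc n * 2"
      by (simp_all add: algebra_simps)
    then show "Suc n * Suc n + n * (n + 1) div 2 = Suc n * (3 * Suc n - 1) div 2"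
      "Suc n * Suc n + Suc n * (Suc n + 1) div 2 = Suc n * (3 * Suc n + 1) div 2"
      by simp_all
  qed
  have "(\<Sum>s\<le>Suc n. shanks_term x (Suc n) s)
      = (\<Sum>s\<le>n. shanks_term x n s) + - ?b n + shanks_term x (Suc n) (Suc n)"
    using * by (simp add: algebra_simps)
  also have "- ?b n = (-1) ^ Suc n * x ^ (Suc n * (3 * Suc n - 1) div 2)"
    unfolding e by simp
  also have "shanks_term x (Suc n) (Suc n) = (-1) ^ Suc n * x ^ (Suc n * (3 * Suc n + 1) div 2)"
    unfolding shanks_term_def e by simp
  finally show ?case
    unfolding Suc.IH by (simp add: algebra_simps)
qed

section \<open>Generalized pentagonal numbers\<close>

lemma omega_double: "2 * omega m = m * (3 * m + 1)"
proof -
  have "even (m * (3 * m + 1))" by simp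
  then show ?thesis unfolding omega_def by simp
qed

text \<open>Makes \<open>nat (omega m)\<close> lossless and confines every m with omega m <= n to
  the interval from -n to n.\<close>

lemma omega_ge_abs: "\<bar>m\<bar> \<le> omega m"
proof -
  have "2 * \<bar>m\<bar> \<le> m * (3 * m + 1)"
  proof (cases "m \<ge> 0")
    case True
    then show ?thesis
      by (cases "m = 0") (auto intro!: mult_left_mono simp: algebra_simps)
  next
    case False
    then have "2 * (-m) \<le> (-(3*m+1)) * (-m)"
      by (intro mult_right_mono) auto
    with False show ?thesis by (simp add: algebra_simps)
  qed
  then show ?thesis unfolding omega_double [symmetric] by simp
qed

text \<open>The doubled difference of two values factors as (a - b)(3(a + b) + 1), and the second
  factor is 1 modulo 3, hence nonzero.\<close>

lemma inj_omega: "inj omega"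
proof
  fix a b assume "omega a = omega b"
  then have "a * (3 * a + 1) = b * (3 * b + 1)"
    by (simp flip: omega_double)
  then have "(a - b) * (3 * (a + b) + 1) = 0"
    by (simp add: algebra_simps)
  moreover have "3 * (a + b) + 1 \<noteq> 0" by presburger
  ultimately show "a = b" by simp
qed

lemma nat_omega_of_nat: "nat (omega (int s)) = s * (3 * s + 1) div 2"
proof -
  have "int (s * (3 * s + 1) div 2) = omega (int s)"
    unfolding omega_def by (simp add: zdiv_int algebra_simps)
  then show ?thesis by linarith
qed

lemma nat_omega_of_neg_nat: "nat (omega (- int s)) = s * (3 * s - 1) div 2"
\<comment> \<open>The subtraction in \<open>3 * s - 1\<close> truncates only at s = 0, where both
  sides are 0.\<close>
proof (cases s)
  case (Suc t)
  have "int (s * (3 * s - 1) div 2) = omega (- int s)"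
    unfolding omega_def Suc by (simp add: zdiv_int algebra_simps)
  then show ?thesis by linarith
qed (simp add: omega_def)

text \<open>Each residue of m modulo 4 gives an explicit factorization: a factor 2 for residues 0
  and 1, only odd factors for 2 and 3.\<close>

lemma even_omega_iff:
  "even (omega m) \<longleftrightarrow> (\<exists>k. m = 4 * k \<or> m = 4 * k + 1)"
proof -
  have o: "omega (4 * k) = 2 * (k * (12 * k + 1))"
    "omega (4 * k + 1) = 2 * ((4 * k + 1) * (3 * k + 1))"
    "omega (4 * k + 2) = (2 * k + 1) * (12 * k + 7)"
    "omega (4 * k + 3) = (4 * k + 3) * (6 * k + 5)" for k
    using omega_double [of "4 * k"] omega_double [of "4 * k + 1"]
      omega_double [of "4 * k + 2"] omega_double [of "4 * k + 3"]
    by (simp_all add: algebra_simps)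
  have "m = 4 * (m div 4) \<or> m = 4 * (m div 4) + 1 \<or> m = 4 * (m div 4) + 2 \<or> m = 4 * (m div 4) + 3"
    by presburger
  then consider k where "m = 4 * k \<or> m = 4 * k + 1" | k where "m = 4 * k + 2 \<or> m = 4 * k + 3"
    by blast
  then show ?thesis
  proof cases
    case 1
    then show ?thesis by (auto simp: o)
  next
    case (2 k)
    then have "odd (omega m)" by (auto simp: o)
    moreover have "m \<noteq> 4 * j \<and> m \<noteq> 4 * j + 1" for j
      using 2 by presburger
    ultimately show ?thesis by blast
  qed
qed

lemma odd_omega_iff:
  "odd (omega m) \<longleftrightarrow> (\<exists>k. m = 4 * k + 2 \<or> m = 4 * k + 3)"
  unfolding even_omega_iff by presburger

section \<open>Coefficients of the Euler product\<close>

lemma sum_symmetric_int_interval: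
  fixes g :: "int \<Rightarrow> 'a::comm_monoid_add"
  shows "(\<Sum>m\<in>{- int n..int n}. g m) = g 0 + (\<Sum>s = 1..n. g (- int s) + g (int s))"
proof (induction n)
  case (Suc n)
  have "{- int (Suc n)..int (Suc n)} = insert (- int (Suc n)) (insert (int (Suc n)) {- int n..int n})"
    by auto
  then show ?case
    using Suc.IH by (simp add: ac_simps)
qed simp

text \<open>Up to degree n the finite product already has the coefficients of the infinite one, so
  truncations suffice throughout.\<close>

lemma euler_prod_fps_X_nth:
  assumes "j \<le> n"
  shows "euler_prod (fps_X :: 'a::comm_ring_1 fps) 0 n $ j =
    (\<Sum>m\<in>{- int n..int n}. if nat (omega m) = j then (-1) ^ nat \<bar>m\<bar> else 0)"
proof -
  have "shanks_term (fps_X :: 'a fps) n s $ j = 0" if "s \<noteq> 0" for s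
  proof -
    \<comment> \<open>For s >= 1 we have s * n >= n, and the triangular number is positive.\<close>
    have "j < s * n + s * (s + 1) div 2"
    proof (cases s)
      case (Suc t)
      then show ?thesis using assms by (simp add: less_Suc_eq_le trans_le_add1)
    qed (use that in simp)
    moreover have "shanks_term (fps_X :: 'a fps) n s
        = fps_X ^ (s * n + s * (s + 1) div 2) * ((-1) ^ s * euler_prod fps_X s n)"
      by (simp add: shanks_term_def ac_simps)
    ultimately show ?thesis by (simp only: fps_X_power_mult_nth if_True)
  qed
  then have "(\<Sum>s\<le>n. shanks_term (fps_X :: 'a fps) n s) $ j
      = (\<Sum>s\<le>n. if s = 0 then shanks_term (fps_X :: 'a fps) n 0 $ j else 0)"
    unfolding fps_sum_nth by (intro sum.cong) auto
  then have "euler_prod (fps_X :: 'a fps) 0 n $ j = (\<Sum>s\<le>n. shanks_term (fps_X :: 'a fps) n s) $ j"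
    by (simp add: shanks_term_def)
  also have "(\<Sum>s\<le>n. shanks_term (fps_X :: 'a fps) n s) =
      (\<Sum>m\<in>{- int n..int n}. (-1) ^ nat \<bar>m\<bar> * fps_X ^ nat (omega m))"
    unfolding shanks_finite_pentagonal sum_symmetric_int_interval
    by (simp add: nat_omega_of_nat nat_omega_of_neg_nat distrib_left) (simp add: omega_def)
  also have "\<dots> $ j = (\<Sum>m\<in>{- int n..int n}. if nat (omega m) = j then (-1) ^ nat \<bar>m\<bar> else 0)"
    unfolding fps_sum_nth
  proof (intro sum.cong refl)
    fix m
    have "(-1 :: 'a fps) ^ k = fps_const ((-1) ^ k)" for k
      by (simp flip: fps_const_power fps_const_neg)
    then show "((-1 :: 'a fps) ^ nat \<bar>m\<bar> * fps_X ^ nat (omega m)) $ j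
        = (if nat (omega m) = j then (-1) ^ nat \<bar>m\<bar> else 0)"
      by auto
  qed
  finally show ?thesis .
qed

lemma of_nat_bit: "(of_nat n :: bit) = of_bool (odd n)"
  by (induction n) auto

text \<open>Signs disappear over the field with two elements, and injectivity of
  \<open>omega\<close> leaves at most one nonzero summand.\<close>

lemma euler_prod_fps_X_nth_bit:
  assumes "j \<le> n"
  shows "euler_prod (fps_X :: bit fps) 0 n $ j = of_bool (\<exists>m. int j = omega m)"
proof (cases "\<exists>m. int j = omega m")
  case True
  then obtain m where m: "int j = omega m" ..
  have *: "nat (omega k) = j \<longleftrightarrow> k = m" for k
  proof -
    have "nat (omega k) = j \<longleftrightarrow> omega k = omega m"
      using m omega_ge_abs [of k] by linarith
    then show ?thesis by (simp add: inj_eq [OF inj_omega])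
  qed
  have "m \<in> {- int n..int n}"
    using omega_ge_abs [of m] m assms by auto
  then show ?thesis
    using True unfolding euler_prod_fps_X_nth [OF assms] * by simp
next
  case False
  have "nat (omega k) \<noteq> j" for k
    using False omega_ge_abs [of k] by (metis abs_ge_zero int_nat_eq order_trans)
  then show ?thesis
    using False unfolding euler_prod_fps_X_nth [OF assms] by simp
qed

section \<open>Generating functions of partitions\<close>

definition partition_gf :: "nat set \<Rightarrow> 'a::comm_ring_1 fps" where
  "partition_gf S = Abs_fps (\<lambda>n. of_nat (card {M. set_mset M \<subseteq> S \<and> \<Sum>\<^sub># M = n}))"

text \<open>A part 0 could be repeated at will without changing the sum. For positive parts, M is
  viewed as an overpartition with nothing overlined.\<close>

lemma finite_partitions:
  fixes S :: "nat set"
  assumes "0 \<notin> S"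
  shows "finite {M. set_mset M \<subseteq> S \<and> \<Sum>\<^sub># M = n}"
proof -
  have "{M. set_mset M \<subseteq> S \<and> \<Sum>\<^sub># M = n} \<subseteq> fst ` {\<pi>. overpartition n \<pi>}"
  proof
    fix M assume "M \<in> {M. set_mset M \<subseteq> S \<and> \<Sum>\<^sub># M = n}"
    then have "overpartition n (M, {#})"
      using assms by (auto simp: overpartition_def intro!: gr0I)
    then show "M \<in> fst ` {\<pi>. overpartition n \<pi>}" by force
  qed
  then show ?thesis
    by (rule finite_subset) (simp add: finite_overpartitions)
qed

text \<open>Deleting one copy of k maps the partitions of n that contain k bijectively to the
  partitions of n - k in which k is still allowed.\<close>

lemma partition_gf_insert:
  assumes "0 \<notin> insert k S" "k \<notin> S"
  shows "(1 - fps_X ^ k) * partition_gf (insert k S) = (partition_gf S :: 'a::comm_ring_1 fps)"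
proof (rule fps_ext)
  fix n
  let ?P = "\<lambda>(S :: nat set) n. {M. set_mset M \<subseteq> S \<and> \<Sum>\<^sub># M = n}"
  have "card (?P (insert k S) n)
      = card (?P S n) + (if n < k then 0 else card (?P (insert k S) (n - k)))"
  proof -
    have "?P (insert k S) n = ?P S n \<union> {M \<in> ?P (insert k S) n. k \<in># M}"
      by auto
    moreover have "?P S n \<inter> {M \<in> ?P (insert k S) n. k \<in># M} = {}"
      using assms by auto
    ultimately have "card (?P (insert k S) n)
        = card (?P S n) + card {M \<in> ?P (insert k S) n. k \<in># M}"
      using finite_partitions [of S n] finite_partitions [of "insert k S" n] assms
      by (metis (no_types, lifting) card_Un_disjoint finite_Un insert_iff)
    moreover have "card {M \<in> ?P (insert k S) n. k \<in># M}
        = (if n < k then 0 else card (?P (insert k S) (n - k)))"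
    proof (cases "n < k")
      case True
      then have "{M \<in> ?P (insert k S) n. k \<in># M} = {}"
        using elem_le_sum_mset by fastforce
      then show ?thesis using True by (simp only: card.empty if_True)
    next
      case False
      have "bij_betw (add_mset k) (?P (insert k S) (n - k)) {M \<in> ?P (insert k S) n. k \<in># M}"
        using False
        by (intro bij_betw_byWitness [where f' = "\<lambda>M. M - {#k#}"])
          (auto dest: in_diffD simp: sum_mset_diff)
      then show ?thesis using False by (simp add: bij_betw_same_card)
    qed
    ultimately show ?thesis by simp
  qed
  then show "((1 - fps_X ^ k) * partition_gf (insert k S)) $ n = (partition_gf S :: 'a fps) $ n"
    by (simp add: left_diff_distrib fps_X_power_mult_nth partition_gf_def)
qed

lemma partition_gf_eq:
  assumes "finite S" "0 \<notin> S"
  shows "(\<Prod>k\<in>S. 1 - fps_X ^ k) * partition_gf S = (1 :: 'a::comm_ring_1 fps)"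
  using assms
proof (induction S)
  case empty
  have "{M. M = {#} \<and> \<Sum>\<^sub># M = n} = (if n = 0 then {{#}} else {})" for n :: nat
    by auto
  then show ?case by (auto simp: fps_eq_iff partition_gf_def)
next
  case (insert k S)
  then have "(1 - fps_X ^ k) * partition_gf (insert k S) = (partition_gf S :: 'a fps)"
    by (intro partition_gf_insert) auto
  moreover have "(\<Prod>j\<in>insert k S. 1 - fps_X ^ j) * partition_gf (insert k S)
      = (\<Prod>j\<in>S. 1 - fps_X ^ j) * ((1 - fps_X ^ k) * partition_gf (insert k S) :: 'a fps)"
    using insert.hyps by (simp add: ac_simps)
  ultimately show ?case using insert by simp
qed

section \<open>Partitions into odd parts modulo 2\<close>

lemma euler_prod_double:
  "euler_prod x 0 (2 * n) = (\<Prod>k | k \<le> 2 * n \<and> odd k. 1 - x ^ k) * euler_prod (x\<^sup>2) 0 n"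
proof -
  have split: "{0<..2 * n} = {k. k \<le> 2 * n \<and> odd k} \<union> (*) 2 ` {0<..n}"
    by (auto elim!: evenE intro: odd_pos)
  have "(\<Prod>k\<in>(*) 2 ` {0<..n}. 1 - x ^ k) = euler_prod (x\<^sup>2) 0 n"
    by (subst prod.reindex) (auto simp: inj_on_def euler_prod_def power_mult)
  then show ?thesis
    unfolding euler_prod_def split by (subst prod.union_disjoint) auto
qed

text \<open>In characteristic 2 squaring is additive; this is applied factor by factor.\<close>

lemma euler_prod_square_bit:
  "euler_prod (fps_X\<^sup>2) 0 n = (euler_prod (fps_X :: bit fps) 0 n)\<^sup>2"
proof -
  have two: "(2 :: bit fps) = 0"
    by (simp add: fps_eq_iff numeral_fps_const)
  have "1 - (fps_X\<^sup>2) ^ k = (1 - fps_X ^ k :: bit fps)\<^sup>2" for k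
  proof -
    have "(1 - fps_X ^ k :: bit fps)\<^sup>2 = 1 - (fps_X\<^sup>2) ^ k - 2 * (fps_X ^ k - (fps_X\<^sup>2) ^ k)"
      by (simp add: power2_eq_square algebra_simps power_mult_distrib)
    then show ?thesis by (simp add: two)
  qed
  then show ?thesis
    by (simp add: euler_prod_def prod_power_distrib)
qed

text \<open>Multiplying by \<open>inverse f\<close> computes coefficient j from coefficients 0 to j
  only, so agreement up to degree n survives the cancellation.\<close>

lemma fps_mult_left_cancel_upto:
  fixes f g h :: "'a::field fps"
  assumes "f $ 0 \<noteq> 0" "\<And>i. i \<le> n \<Longrightarrow> (f * g) $ i = (f * h) $ i" "j \<le> n"
  shows "g $ j = h $ j"
proof -
  have "k = inverse f * (f * k)" for k
    using assms(1) by (simp add: inverse_mult_eq_1 flip: mult.assoc)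
  then have "k $ j = (\<Sum>i = 0..j. inverse f $ i * (f * k) $ (j - i))" for k
    by (metis fps_mult_nth)
  then show ?thesis using assms(2,3) by simp
qed

text \<open>With D the product over odd k and G its inverse, P = D P^2 gives P G = P^2. Cancelling P
  yields G = P, here up to degree n.\<close>

lemma odd_card_odd_partitions:
  "odd (card {M. (\<forall>p\<in>#M. odd p) \<and> \<Sum>\<^sub># M = n}) \<longleftrightarrow> (\<exists>m. int n = omega m)"
proof -
  \<comment> \<open>The bound 2 * n matches \<open>euler_prod_double\<close>; a partition of n has
    no part above n anyway.\<close>
  define S where "S = {k. k \<le> 2 * n \<and> odd k}"
  define P where "P = euler_prod (fps_X :: bit fps) 0"
  define G :: "bit fps" where "G = partition_gf S"
  have "finite S" "0 \<notin> S" by (auto simp: S_def)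
  then have "(\<Prod>k\<in>S. 1 - fps_X ^ k) * G = 1"
    unfolding G_def by (rule partition_gf_eq)
  moreover have "P (2 * n) = (\<Prod>k\<in>S. 1 - fps_X ^ k) * (P n)\<^sup>2"
    by (simp only: P_def euler_prod_double S_def euler_prod_square_bit)
  ultimately have "P (2 * n) * G = P n * P n"
    by (simp add: power2_eq_square mult.commute mult.left_commute)
  \<comment> \<open>The squaring step relates two truncations, P (2 * n) and P n, which are
    interchangeable only in low degrees.\<close>
  moreover have "P (2 * n) $ i = P n $ i" if "i \<le> n" for i
    using that by (simp add: P_def euler_prod_fps_X_nth_bit)
  then have "(P n * G) $ i = (P (2 * n) * G) $ i" if "i \<le> n" for i
    unfolding fps_mult_nth using that by (intro sum.cong) auto
  ultimately have agree: "(P n * G) $ i = (P n * P n) $ i" if "i \<le> n" for i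
    using that by simp
  have "\<exists>m. int 0 = omega m"
    by (rule exI [of _ 0]) (simp add: omega_def)
  then have nz: "P n $ 0 \<noteq> 0"
    unfolding P_def euler_prod_fps_X_nth_bit [OF le0] by simp
  have "G $ n = P n $ n"
    by (rule fps_mult_left_cancel_upto [OF nz agree order_refl])
  moreover have "{M. set_mset M \<subseteq> S \<and> \<Sum>\<^sub># M = n} = {M. (\<forall>p\<in>#M. odd p) \<and> \<Sum>\<^sub># M = n}"
    unfolding S_def using elem_le_sum_mset by fastforce
  ultimately have "(of_nat (card {M. (\<forall>p\<in>#M. odd p) \<and> \<Sum>\<^sub># M = n}) :: bit)
      = of_bool (\<exists>m. int n = omega m)"
    by (simp add: G_def partition_gf_def P_def euler_prod_fps_X_nth_bit)
  then show ?thesis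
    by (simp only: of_nat_bit of_bool_eq_iff)
qed

section \<open>The overline-toggling involution\<close>

definition max_even_part :: "nat multiset \<times> nat multiset \<Rightarrow> nat" where
  "max_even_part \<pi> = Max {p \<in> set_mset (fst \<pi> + snd \<pi>). even p}"

text \<open>The move preserves \<open>fst \<pi> + snd \<pi>\<close>, on which alone the chosen part
  depends, so a second application selects the same part.\<close>

definition toggle_overline :: "nat multiset \<times> nat multiset \<Rightarrow> nat multiset \<times> nat multiset" where
  "toggle_overline \<pi> = (let p = max_even_part \<pi> in
     if p \<in># snd \<pi> then (add_mset p (fst \<pi>), snd \<pi> - {#p#})
     else (fst \<pi> - {#p#}, add_mset p (snd \<pi>)))"

lemma max_even_part:
  assumes "\<exists>p \<in># \<mu> + \<nu>. even p"
  shows "max_even_part (\<mu>, \<nu>) \<in># \<mu> + \<nu>" "even (max_even_part (\<mu>, \<nu>))"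
proof -
  have "max_even_part (\<mu>, \<nu>) \<in> {p \<in> set_mset (\<mu> + \<nu>). even p}"
    unfolding max_even_part_def fst_conv snd_conv using assms by (intro Max_in) auto
  then show "max_even_part (\<mu>, \<nu>) \<in># \<mu> + \<nu>" "even (max_even_part (\<mu>, \<nu>))" by auto
qed

text \<open>Toggling keeps the number of parts, so an arbitrary condition Q on that number can be
  carried along.\<close>

lemma even_card_overpartitions_with_even_part:
  "even (card {(\<mu>, \<nu>). overpartition n (\<mu>, \<nu>) \<and> even_overlined (\<mu>, \<nu>) \<and>
     Q (num_parts (\<mu>, \<nu>)) \<and> (\<exists>p \<in># \<mu> + \<nu>. even p)})" (is "even (card ?X)")
proof -
  have toggle: "toggle_overline \<pi> \<in> ?X \<and> toggle_overline (toggle_overline \<pi>) = \<pi> \<and> toggle_overline \<pi> \<noteq> \<pi>"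
    if "\<pi> \<in> ?X" for \<pi>
  proof -
    obtain \<mu> \<nu> where \<pi>: "\<pi> = (\<mu>, \<nu>)" by (cases \<pi>)
    define p where "p = max_even_part (\<mu>, \<nu>)"
    have X: "\<And>p. p \<in># \<mu> \<Longrightarrow> 0 < p" "\<And>p. p \<in># \<nu> \<Longrightarrow> 0 < p" "\<And>p. count \<nu> p \<le> 1"
      "\<Sum>\<^sub># \<mu> + \<Sum>\<^sub># \<nu> = n" "\<And>p. p \<in># \<nu> \<Longrightarrow> even p" "Q (size \<mu> + size \<nu>)" "\<exists>p \<in># \<mu> + \<nu>. even p"
      using that by (auto simp: \<pi> overpartition_def even_overlined_def num_parts_def)
    have p: "p \<in># \<mu> + \<nu>" "even p"
      unfolding p_def using max_even_part [OF X(7)] by auto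
    have inv: "max_even_part (\<mu>', \<nu>') = p" if "\<mu>' + \<nu>' = \<mu> + \<nu>" for \<mu>' \<nu>'
      using that by (simp add: p_def max_even_part_def)
    show ?thesis
    proof (cases "p \<in># \<nu>")
      case True
      then obtain \<nu>' where \<nu>: "\<nu> = add_mset p \<nu>'" by (metis mset_add)
      have "toggle_overline \<pi> = (add_mset p \<mu>, \<nu> - {#p#})"
        using True by (simp add: toggle_overline_def \<pi> p_def [symmetric] Let_def)
      then have t: "toggle_overline \<pi> = (add_mset p \<mu>, \<nu>')" by (simp add: \<nu>)
      \<comment> \<open>At most one copy of p is overlined, so none is left and the next toggle
        overlines p again.\<close>
      have "p \<notin># \<nu>'"
        using X(3) [of p] by (simp add: \<nu> not_in_iff)
      moreover have "max_even_part (add_mset p \<mu>, \<nu>') = p"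
        by (rule inv) (simp add: \<nu>)
      ultimately have "toggle_overline (toggle_overline \<pi>) = \<pi>"
        unfolding t by (simp add: toggle_overline_def Let_def \<pi> \<nu>)
      moreover have "count \<nu>' q \<le> 1" for q
        using X(3) [of q] by (simp add: \<nu> split: if_splits)
      then have "toggle_overline \<pi> \<in> ?X"
        unfolding t using X p
        by (auto simp: overpartition_def even_overlined_def num_parts_def \<nu>)
      moreover have "toggle_overline \<pi> \<noteq> \<pi>"
        by (simp only: t) (simp add: \<pi>)
      ultimately show ?thesis by blast
    next
      case False
      then have "p \<in># \<mu>" using p by simp
      then obtain \<mu>' where \<mu>: "\<mu> = add_mset p \<mu>'" by (metis mset_add)
      have "toggle_overline \<pi> = (\<mu> - {#p#}, add_mset p \<nu>)"
        using False by (simp add: toggle_overline_def \<pi> p_def [symmetric] Let_def)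
      then have t: "toggle_overline \<pi> = (\<mu>', add_mset p \<nu>)" by (simp add: \<mu>)
      have "max_even_part (\<mu>', add_mset p \<nu>) = p"
        by (rule inv) (simp add: \<mu>)
      then have "toggle_overline (toggle_overline \<pi>) = \<pi>"
        unfolding t by (simp add: toggle_overline_def Let_def \<pi> \<mu>)
      moreover have "count (add_mset p \<nu>) q \<le> 1" for q
        using X(3) [of q] False by (cases "p = q") (auto simp: not_in_iff)
      then have "toggle_overline \<pi> \<in> ?X"
        unfolding t using X p
        by (auto simp: overpartition_def even_overlined_def num_parts_def \<mu>)
      moreover have "toggle_overline \<pi> \<noteq> \<pi>"
        by (simp only: t) (simp add: \<pi>)
      ultimately show ?thesis by blast
    qed
  qed
  \<comment> \<open>Over the field with two elements the contributions of each toggled pair cancel,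
    and the sum is the cardinality modulo 2.\<close>
  have "(\<Sum>\<pi>\<in>?X. 1 :: bit) = 0"
    by (rule sum_involution_eq_0 [where h = toggle_overline]) (use toggle in auto)
  then show ?thesis
    by (simp add: of_nat_bit)
qed

section \<open>Reduction to odd parts and conclusion\<close>

lemma even_size_iff_even_sum_mset:
  fixes M :: "nat multiset"
  assumes "\<forall>p \<in># M. odd p"
  shows "even (size M) \<longleftrightarrow> even (\<Sum>\<^sub># M)"
  using assms by (induction M) auto

text \<open>Q covers \<open>even\<close> and \<open>odd\<close> at once. A partition of n into odd
  parts has length congruent to n modulo 2, so Q of the length becomes Q n.\<close>

lemma odd_card_overpartitions_by_num_parts:
  fixes Q :: "nat \<Rightarrow> bool"
  assumes Q: "\<And>a b. even a = even b \<Longrightarrow> Q a = Q b"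
  shows "odd (card {\<pi>. overpartition n \<pi> \<and> even_overlined \<pi> \<and> Q (num_parts \<pi>)})
    \<longleftrightarrow> Q n \<and> (\<exists>m. int n = omega m)"
proof -
  let ?A = "{\<pi>. overpartition n \<pi> \<and> even_overlined \<pi> \<and> Q (num_parts \<pi>)}"
  let ?X = "{(\<mu>, \<nu>). overpartition n (\<mu>, \<nu>) \<and> even_overlined (\<mu>, \<nu>) \<and>
     Q (num_parts (\<mu>, \<nu>)) \<and> (\<exists>p \<in># \<mu> + \<nu>. even p)}"
  let ?O = "{M. (\<forall>p \<in># M. odd p) \<and> \<Sum>\<^sub># M = n}"
  have fin: "finite ?A" by (rule finite_subset [OF _ finite_overpartitions [of n]]) auto
  have sub: "?X \<subseteq> ?A" by auto
  \<comment> \<open>Without any even part nothing can be overlined, so the second component is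
    empty.\<close>
  have "?A - ?X = {(\<mu>, \<nu>). Q n \<and> \<nu> = {#} \<and> \<mu> \<in> ?O}" (is "_ = ?R")
  proof -
    have "(\<mu>, \<nu>) \<in> ?A - ?X \<longleftrightarrow> Q n \<and> \<nu> = {#} \<and> \<mu> \<in> ?O" for \<mu> \<nu>
    proof
      assume *: "(\<mu>, \<nu>) \<in> ?A - ?X"
      then have odd: "\<forall>p \<in># \<mu> + \<nu>. odd p" by auto
      with * have "\<nu> = {#}"
        by (auto simp: even_overlined_def)
      with * odd show "Q n \<and> \<nu> = {#} \<and> \<mu> \<in> ?O"
        using even_size_iff_even_sum_mset [of \<mu>] Q [of "size \<mu>" n]
        by (auto simp: overpartition_def num_parts_def)
    next
      assume *: "Q n \<and> \<nu> = {#} \<and> \<mu> \<in> ?O"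
      then have "Q (size \<mu>)"
        using even_size_iff_even_sum_mset [of \<mu>] Q [of "size \<mu>" n] by auto
      with * show "(\<mu>, \<nu>) \<in> ?A - ?X"
        by (auto simp: overpartition_def num_parts_def even_overlined_def intro: odd_pos)
    qed
    then have "\<pi> \<in> ?A - ?X \<longleftrightarrow> \<pi> \<in> ?R" for \<pi>
      by (cases \<pi>) (simp only: mem_Collect_eq case_prod_conv)
    then show ?thesis by (rule set_eqI)
  qed
  also have "?R = (if Q n then (\<lambda>M. (M, {#})) ` ?O else {})"
    by auto
  finally have "card (?A - ?X) = (if Q n then card ?O else 0)"
    by (simp add: card_image inj_on_def)
  moreover have "card ?A = card ?X + card (?A - ?X)"
    using fin sub by (metis (no_types, lifting) card_mono card_Diff_subset finite_subset le_add_diff_inverse)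
  ultimately show ?thesis
    using even_card_overpartitions_with_even_part [of n Q] odd_card_odd_partitions [of n] by auto
qed

theorem theorem4:
  fixes n :: nat
  shows "[d2e n = (if \<exists>k :: int. int n = omega (4 * k) \<or> int n = omega (4 * k + 1)
                    then 1 else 0)] (mod 2)
       \<and> [d2o n = (if \<exists>k :: int. int n = omega (4 * k + 2) \<or> int n = omega (4 * k + 3)
                    then 1 else 0)] (mod 2)"
proof -
  \<comment> \<open>The parity of n = omega m determines whether m is 0 or 1, or else 2 or 3, modulo
    4.\<close>
  have "even n \<and> (\<exists>m. int n = omega m)
      \<longleftrightarrow> (\<exists>k. int n = omega (4 * k) \<or> int n = omega (4 * k + 1))"
    by (metis even_omega_iff even_of_nat_iff)
  then have "odd (d2e n) \<longleftrightarrow> (\<exists>k. int n = omega (4 * k) \<or> int n = omega (4 * k + 1))"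
    unfolding d2e_def by (subst odd_card_overpartitions_by_num_parts) auto
  moreover have "odd n \<and> (\<exists>m. int n = omega m)
      \<longleftrightarrow> (\<exists>k. int n = omega (4 * k + 2) \<or> int n = omega (4 * k + 3))"
    by (metis odd_omega_iff even_of_nat_iff)
  then have "odd (d2o n) \<longleftrightarrow> (\<exists>k. int n = omega (4 * k + 2) \<or> int n = omega (4 * k + 3))"
    unfolding d2o_def by (subst odd_card_overpartitions_by_num_parts) auto
  ultimately show ?thesis
    by (auto simp: cong_def mod2_eq_if)
qed

end
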